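(* Let $f:\mathbb{R}^n\to\mathbb{R}^n$ and $g^t:\mathcal{C}([-r,0],\mathbb{R}^n)\to\mathbb{R}^n$ ($t\ge 0$) satisfy the standing assumptions listed in the context. Suppose that the undelayed system $\frac{dy}{dt}(t)=f(y(t))+g^t(y(t)\mathbb{1})$ admits a solution $y(t)$, $t\ge0$, satisfying $y_i(0)>0$ and $\lim_{t\to\infty}y_i(t)=0$ for all components $i$. For $0\le a\le y_i(0)$ define $T_i(a):=\sup\{\tau : a\le y_i(s)\ \forall s\in[0,\tau]\}$, and for $u\ge 0$ define $h_i(u):=\inf\{\tau\ge u : \exists\, a\in[0,y_i(0)] \text{ such that } T_i(a)=\tau\}$. Let $t^p\ge 0$ be a time for which $y(t^p)\ll y(0)$, and define $\zeta\in\mathbb{R}^n_+$ by $\zeta_i:=y_i(h_i(t^p))$ for all $i$. Then any solution of the delayed system $\frac{dx}{dt}(t)=f(x(t))+g^t(x_t)$ with initial condition $x_{t_0}\in\mathcal{C}([-r,0],[0,\zeta])$ satisfies $\lim_{t\to\infty}x(t)=0$.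
   Context: Notation: for $x,y\in\mathbb{R}^n$, $x\le y$ means $x_i\le y_i$ for all $i$; $x\ll y$ means $x_i<y_i$ for all $i$; $[x,y]=\{z: x\le z\le y\}$. $\mathbb{R}^n_+=\{x\in\mathbb{R}^n: x\ge 0\}$. $r\ge 0$ is a fixed delay bound; $\mathcal{C}([-r,0],\mathbb{R}^n)$ is the Banach space of continuous functions $[-r,0]\to\mathbb{R}^n$ with the sup norm, and $\phi\le\psi$ means $\phi(\theta)\le\psi(\theta)$ for all $\theta\in[-r,0]$. For $v\in\mathbb{R}^n$, $v\mathbb{1}$ is the constant function on $[-r,0]$ with value $v$. For a function $x(t)$, $x_t\in\mathcal{C}([-r,0],\mathbb{R}^n)$ is $x_t(\theta)=x(t+\theta)$. $\mathcal{C}([-r,0],A)$ denotes those functions with values in $A$. Standing assumptions on $f$ and $g^t$: (1) if $x\le y$ and $x_i=y_i$ then $f_i(x)\le f_i(y)$, for all $x,y\in\mathbb{R}^n$; (2) if $\phi\le\psi$ then $g^t(\phi)\le g^t(\psi)$, for all $\phi,\psi\in\mathcal{C}([-r,0],\mathbb{R}^n)$ and $t\ge 0$; (3) $t\mapsto g^t(\phi)$ is continuous for each fixed $\phi$; $f$ is locally Lipschitz, and $\phi\mapsto g^t(\phi)$ is locally Lipschitz for each fixed $t\ge0$; the delayed and undelayed systems have unique solutions through each initial datum, depending continuously on the initial data; (4) for each $v\in\mathbb{R}^n$, $g^t(v\mathbb{1})$ is independent of $t$; (5) the origin is an equilibrium: $f(0)+g^0(0\,\mathbb{1})=0$. A solution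 of the delayed system with initial condition $x_{t_0}$ at time $t_0\ge 0$ satisfies the equation for $t\ge t_0$. The supremum $T_i(a)$ may take the value $+\infty$. *)

theory Defs
  imports "HOL-Analysis.Analysis"
begin

text \<open>
  The order \<open>\<le>\<close> on \<^typ>\<open>real^'n\<close> is the componentwise one and \<open>{x..y}\<close> is the order interval,
  but \<open><\<close> is the strict part of \<open>\<le>\<close>; the relation "strictly less in every component" is
  therefore always written out.
\<close>

definition history_space :: "real \<Rightarrow> (real \<Rightarrow> real^'n) metric" where
  "history_space r = cfunspace (top_of_set {-r..0}) euclidean_metric"

definition histories :: "real \<Rightarrow> (real^'n) set \<Rightarrow> (real \<Rightarrow> real^'n) set" where
  "histories r A = {\<phi> \<in> mspace (history_space r). \<forall>\<theta>\<in>{-r..0}. \<phi> \<theta> \<in> A}"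

lemma mspace_history_space:
  "mspace (history_space r) = {\<phi>. continuous_on {-r..0} \<phi> \<and> \<phi> \<in> extensional {-r..0}}"
proof -
  have "bounded (\<phi> ` {-r..0})" if "continuous_on {-r..0} \<phi>" for \<phi> :: "real \<Rightarrow> real^'n"
    using that by (intro compact_imp_bounded compact_continuous_image) auto
  then show ?thesis
    unfolding history_space_def by auto
qed

lemma mdist_history_space:
  assumes "0 \<le> r" "\<phi> \<in> mspace (history_space r)" "\<psi> \<in> mspace (history_space r)"
  shows "mdist (history_space r) \<phi> \<psi> = (SUP \<theta>\<in>{-r..0}. norm (\<phi> \<theta> - \<psi> \<theta>))"
proof -
  have "\<phi> \<in> Met_TC.fspace {-r..0}" "\<psi> \<in> Met_TC.fspace {-r..0}"
    using assms(2,3) by (auto simp: history_space_def Met_TC.fspace_def)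
  then show ?thesis
    using assms(1)
    by (simp add: history_space_def mdist_cfunspace_eq_mdist_funspace Met_TC.fdist_def dist_norm)
qed

definition const_history :: "real \<Rightarrow> real^'n \<Rightarrow> real \<Rightarrow> real^'n" where
  "const_history r v = restrict (\<lambda>_. v) {-r..0}"

definition segment :: "real \<Rightarrow> (real \<Rightarrow> real^'n) \<Rightarrow> real \<Rightarrow> real \<Rightarrow> real^'n" where
  "segment r x t = restrict (\<lambda>\<theta>. x (t + \<theta>)) {-r..0}"

text \<open>
  Solutions of the delayed and of the undelayed system with initial datum at time \<open>t0\<close>, on a time
  interval \<open>J\<close> whose least element is \<open>t0\<close> (where the derivative is one-sided).
\<close>

definition delayed_solution ::
  "real \<Rightarrow> (real^'n \<Rightarrow> real^'n) \<Rightarrow> (real \<Rightarrow> (real \<Rightarrow> real^'n) \<Rightarrow> real^'n) \<Rightarrow>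
   real set \<Rightarrow> real \<Rightarrow> (real \<Rightarrow> real^'n) \<Rightarrow> (real \<Rightarrow> real^'n) \<Rightarrow> bool" where
  "delayed_solution r f g J t0 \<phi> x \<longleftrightarrow>
     segment r x t0 = \<phi> \<and>
     (\<forall>t\<in>J. (x has_vector_derivative (f (x t) + g t (segment r x t))) (at t within J))"

definition undelayed_solution ::
  "real \<Rightarrow> (real^'n \<Rightarrow> real^'n) \<Rightarrow> (real \<Rightarrow> (real \<Rightarrow> real^'n) \<Rightarrow> real^'n) \<Rightarrow>
   real set \<Rightarrow> real \<Rightarrow> real^'n \<Rightarrow> (real \<Rightarrow> real^'n) \<Rightarrow> bool" where
  "undelayed_solution r f g J t0 v y \<longleftrightarrow>
     y t0 = v \<and>
     (\<forall>t\<in>J. (y has_vector_derivative (f (y t) + g t (const_history r (y t)))) (at t within J))"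

text \<open>
  Existence (local in time), uniqueness, and continuous dependence on the initial datum, for a
  system with state space \<open>S\<close>; \<open>sol J t0 \<phi> x\<close> reads "\<open>x\<close> solves the system on \<open>J\<close> with datum \<open>\<phi>\<close> at
  time \<open>t0\<close>". Solutions are not required to exist for all time, but for data close to \<open>\<phi>\<close> they
  exist on every compact interval on which the solution through \<open>\<phi>\<close> does.
\<close>

definition well_posed ::
  "'s metric \<Rightarrow> (real set \<Rightarrow> real \<Rightarrow> 's \<Rightarrow> (real \<Rightarrow> real^'n) \<Rightarrow> bool) \<Rightarrow> bool" where
  "well_posed S sol \<longleftrightarrow> (\<forall>t0\<ge>0. \<forall>\<phi>\<in>mspace S.
     (\<exists>b>t0. \<exists>x. sol {t0..b} t0 \<phi> x) \<and>
     (\<forall>b>t0. \<forall>x z. sol {t0..b} t0 \<phi> x \<longrightarrow> sol {t0..b} t0 \<phi> z \<longrightarrow> (\<forall>t\<in>{t0..b}. x t = z t)) \<and>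
     (\<forall>b>t0. \<forall>x. sol {t0..b} t0 \<phi> x \<longrightarrow>
        (\<forall>\<epsilon>>0. \<exists>\<delta>>0. \<forall>\<psi>\<in>mball_of S \<phi> \<delta>.
           \<exists>z. sol {t0..b} t0 \<psi> z \<and> (\<forall>t\<in>{t0..b}. dist (z t) (x t) < \<epsilon>))))"

locale delay_system =
  fixes r :: real
    and f :: "real^'n \<Rightarrow> real^'n"
    and g :: "real \<Rightarrow> (real \<Rightarrow> real^'n) \<Rightarrow> real^'n"
  assumes delay_nonneg: "0 \<le> r"
    and f_cooperative: "\<And>x y i. x \<le> y \<Longrightarrow> x $ i = y $ i \<Longrightarrow> f x $ i \<le> f y $ i"
    and g_mono: "\<And>t \<phi> \<psi>. 0 \<le> t \<Longrightarrow> \<phi> \<in> mspace (history_space r) \<Longrightarrow>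
        \<psi> \<in> mspace (history_space r) \<Longrightarrow> (\<forall>\<theta>\<in>{-r..0}. \<phi> \<theta> \<le> \<psi> \<theta>) \<Longrightarrow> g t \<phi> \<le> g t \<psi>"
    and g_continuous: "\<And>\<phi>. \<phi> \<in> mspace (history_space r) \<Longrightarrow> continuous_on {0..} (\<lambda>t. g t \<phi>)"
    and f_locally_Lipschitz: "\<And>x. \<exists>u>0. \<exists>L. L-lipschitz_on (cball x u) f"
    and g_locally_Lipschitz: "\<And>t \<phi>. 0 \<le> t \<Longrightarrow> \<phi> \<in> mspace (history_space r) \<Longrightarrow>
        \<exists>u>0. Lipschitz_continuous_map
          (submetric (history_space r) (mball_of (history_space r) \<phi> u)) euclidean_metric (g t)"
    and delayed_well_posed: "well_posed (history_space r) (delayed_solution r f g)"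
    and undelayed_well_posed: "well_posed euclidean_metric (undelayed_solution r f g)"
    and g_const_history: "\<And>s t v. 0 \<le> s \<Longrightarrow> 0 \<le> t \<Longrightarrow>
        g s (const_history r v) = g t (const_history r v)"
    and equilibrium: "f 0 + g 0 (const_history r 0) = 0"

text \<open>
  Applied to a component \<open>\<eta>\<close> of a trajectory, the next two definitions give \<open>T\<^sub>i(a)\<close> and \<open>h\<^sub>i(u)\<close>.
\<close>

definition level_time :: "(real \<Rightarrow> real) \<Rightarrow> real \<Rightarrow> ereal" where
  "level_time \<eta> a = Sup (ereal ` {\<tau>. 0 \<le> \<tau> \<and> (\<forall>s\<in>{0..\<tau>}. a \<le> \<eta> s)})"

definition next_level_time :: "(real \<Rightarrow> real) \<Rightarrow> real \<Rightarrow> ereal" where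
  "next_level_time \<eta> u = Inf {\<tau>. ereal u \<le> \<tau> \<and> (\<exists>a\<in>{0..\<eta> 0}. level_time \<eta> a = \<tau>)}"

text \<open>
  For a positive continuous \<open>\<eta>\<close> tending to \<open>0\<close> the value \<open>next_level_time \<eta> u\<close> is finite, so the
  coercion below is harmless. (A solution of a \<open>delay_system\<close> whose components are positive at time
  \<open>0\<close> keeps them positive, because the undelayed system is cooperative, locally Lipschitz and has
  the origin as an equilibrium.)
\<close>

definition level_vector :: "(real \<Rightarrow> real^'n) \<Rightarrow> real \<Rightarrow> real^'n" where
  "level_vector y u = (\<chi> i. y (real_of_ereal (next_level_time (\<lambda>t. y t $ i) u)) $ i)"

end

theory Submission
  imports Defs
begin

text \<open>
  Write \<open>F v\<close> for the right-hand side of the undelayed system. It is cooperative, because \<open>f\<close> is and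
  the delayed term is monotone; and it does not depend on time, because constant histories are
  mapped to the same value at all times. The whole proof compares the delayed system with \<open>F\<close>: if a
  history is bounded above by the constant \<open>v\<close>, then monotonicity bounds the delayed term by its
  value at the constant history \<open>v\<close>, uniformly in time.

  The vector \<open>\<zeta>\<close> is the running minimum of the undelayed trajectory: \<open>\<zeta>\<^sub>i\<close> is the least value of \<open>y\<^sub>i\<close>
  on \<open>[0, tp]\<close> (\<open>level_vector_running_minimum\<close>). It satisfies \<open>F \<zeta> \<le> 0\<close>
  (\<open>undelayed_field_level_vector_le_0\<close>): at a time \<open>s\<close> where component \<open>i\<close> attains its minimum, \<open>\<zeta> \<le> y s\<close>
  with equality in component \<open>i\<close>, so \<open>F\<^sub>i \<zeta> \<le> F\<^sub>i (y s) = y\<^sub>i' s \<le> 0\<close>. The last inequality requires \<open>s > 0\<close>,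
  and this holds because every component is smaller at time \<open>tp\<close> than at time \<open>0\<close>.

  Hence the order interval \<open>[0, \<zeta>]\<close> is invariant under the delayed system
  (\<open>delayed_below_superequilibrium\<close>, \<open>delayed_nonneg\<close>). Let \<open>w\<close> be the componentwise upper limit of the
  delayed solution \<open>x\<close>. If \<open>F\<^sub>i w\<close> were negative, then \<open>x\<^sub>i\<close> would eventually decrease at a fixed rate
  whenever it is close to \<open>w\<^sub>i\<close> or above, and would stay away from \<open>w\<^sub>i\<close>; so \<open>F w \<ge> 0\<close>
  (\<open>undelayed_field_limsup_nonneg\<close>). But \<open>w \<le> \<zeta> \<le> y 0\<close>, and an undelayed trajectory that starts above a
  point with \<open>F w \<ge> 0\<close> stays above it (\<open>undelayed_above_subequilibrium\<close>). As \<open>y\<close> tends to \<open>0\<close>, this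
  leaves only \<open>w = 0\<close>.
\<close>

section \<open>Barriers\<close>

text \<open>
  Only the first time at which some component reaches \<open>0\<close> matters. Up to then all components are at
  most \<open>0\<close>, which is exactly what an estimate by cooperativity needs; and a component that reaches
  \<open>0\<close> from below cannot have a negative derivative there.
\<close>

lemma stays_below_barrier:
  fixes u :: "'n::finite \<Rightarrow> real \<Rightarrow> real"
  assumes der: "\<And>i t. t \<in> {a..b} \<Longrightarrow> (u i has_real_derivative u' i t) (at t within {a..b})"
    and start: "\<And>i. u i a < 0"
    and touch: "\<And>i t. a < t \<Longrightarrow> t \<le> b \<Longrightarrow> (\<forall>j. \<forall>s\<in>{a..t}. u j s \<le> 0) \<Longrightarrow> u i t = 0 \<Longrightarrow> u' i t < 0"
    and t: "t \<in> {a..b}"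
  shows "u i t < 0"
proof (rule ccontr)
  assume "\<not> u i t < 0"
  define S where "S = (\<Union>j. {s \<in> {a..b}. 0 \<le> u j s})"
  have cont: "continuous_on {a..b} (u j)" for j
    using der by (meson DERIV_continuous continuous_on_eq_continuous_within)
  have "closed S"
    unfolding S_def
    by (intro closed_UN finite ballI continuous_on_closed_Collect_le continuous_on_const cont closed_atLeastAtMost)
  moreover have tS: "t \<in> S"
    using t \<open>\<not> u i t < 0\<close> by (auto simp: S_def not_less)
  moreover have bdd: "bdd_below S"
    by (rule bdd_belowI[of _ a]) (auto simp: S_def)
  ultimately have inS: "Inf S \<in> S"
    by (metis closed_contains_Inf empty_iff)
  define \<tau> where "\<tau> = Inf S"
  have before: "u j s < 0" if "a \<le> s" "s < \<tau>" for j s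
  proof (rule ccontr)
    assume "\<not> u j s < 0"
    moreover have "\<tau> \<le> b" using inS by (auto simp: S_def \<tau>_def)
    ultimately have "s \<in> S" using that by (auto simp: S_def not_less)
    then show False using cInf_lower[OF _ bdd] that by (fastforce simp: \<tau>_def)
  qed
  obtain k where k: "0 \<le> u k \<tau>" and \<tau>: "a \<le> \<tau>" "\<tau> \<le> b"
    using inS by (auto simp: S_def \<tau>_def)
  have "a < \<tau>" using start[of k] k \<tau> by (cases "a = \<tau>") auto
  have at: "u j \<tau> \<le> 0" for j
  proof (rule ccontr)
    assume "\<not> u j \<tau> \<le> 0"
    then obtain s where "a \<le> s" "s \<le> \<tau>" "u j s = 0"
      using IVT'[of "u j" a 0 \<tau>] start[of j] \<tau> continuous_on_subset[OF cont, of "{a..\<tau>}" j] by force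
    with before[of s j] \<open>\<not> u j \<tau> \<le> 0\<close> show False by (cases "s = \<tau>") auto
  qed
  have "u' k \<tau> < 0"
  proof (rule touch[OF \<open>a < \<tau>\<close> \<open>\<tau> \<le> b\<close>])
    show "\<forall>j. \<forall>s\<in>{a..\<tau>}. u j s \<le> 0"
      using at before by (metis atLeastAtMost_iff less_eq_real_def)
    show "u k \<tau> = 0" using k at[of k] by simp
  qed
  then obtain d where d: "d > 0" "\<And>h. h > 0 \<Longrightarrow> \<tau> - h \<in> {a..b} \<Longrightarrow> h < d \<Longrightarrow> u k \<tau> < u k (\<tau> - h)"
    using has_real_derivative_neg_dec_left[OF der[of \<tau> k]] \<tau> by auto
  define h where "h = min (d/2) (\<tau> - a)"
  have "u k \<tau> < u k (\<tau> - h)"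
    using d(1) \<open>a < \<tau>\<close> \<tau> by (intro d(2)) (auto simp: h_def)
  moreover have "u k (\<tau> - h) < 0"
    using d(1) \<open>a < \<tau>\<close> \<tau> by (intro before) (auto simp: h_def)
  ultimately show False using k by simp
qed

lemma has_real_derivative_vec_nth:
  assumes "(X has_vector_derivative D) (at t within S)"
  shows "((\<lambda>t. X t $ i) has_real_derivative D $ i) (at t within S)"
  using bounded_linear.has_vector_derivative[OF bounded_linear_vec_nth assms, of i]
  by (simp add: has_real_derivative_iff_has_vector_derivative)

text \<open>
  Invariance of \<open>{.. z}\<close> under a merely weak inequality on the boundary. The barrier \<open>z\<close> is raised in all
  components by the same exponentially growing amount, which outgrows the linear error \<open>L * e\<close>, and
  this amount is then sent to \<open>0\<close>. The raised barrier grows in time, so the current height \<open>e\<close> also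
  bounds \<open>X\<close> at all earlier times; delayed equations need this.
\<close>

lemma stays_below_equal_bound:
  fixes X X' :: "real \<Rightarrow> real^'n"
  assumes der: "\<And>t. a \<le> t \<Longrightarrow> (X has_vector_derivative X' t) (at t within {a..})"
    and start: "X a \<le> z"
    and \<kappa>: "0 < \<kappa>"
    and touch: "\<And>t i e. a \<le> t \<Longrightarrow> 0 < e \<Longrightarrow> e \<le> \<kappa> \<Longrightarrow> (\<forall>s\<in>{a..t}. X s \<le> z + e *\<^sub>R 1) \<Longrightarrow>
        X t $ i = z $ i + e \<Longrightarrow> X' t $ i \<le> L * e"
    and t: "a \<le> t"
  shows "X t \<le> z"
proof -
  define M where "M = \<bar>L\<bar> + 1"
  have M: "M > 0" "L < M" by (auto simp: M_def)
  have main: "X t $ i < z $ i + e" if e: "0 < e" "e \<le> \<kappa>" for e i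
  proof -
    \<comment> \<open>Normalised to have height \<open>e\<close> at the final time, so that it never exceeds \<open>\<kappa>\<close>.\<close>
    define E where "E s = e * exp (M * (s - t))" for s
    have E_pos: "0 < E s" for s using e by (simp add: E_def)
    have E_mono: "E s \<le> E s'" if "s \<le> s'" for s s'
      using that e M by (simp add: E_def)
    have E_t: "E t = e" by (simp add: E_def)
    have "X t $ i - z $ i - E t < 0"
    proof (rule stays_below_barrier[where u="\<lambda>i s. X s $ i - z $ i - E s" and a=a and b=t
            and u'="\<lambda>i s. X' s $ i - M * E s"])
      show "t \<in> {a..t}" using t by simp
    next
      fix i s assume s: "s \<in> {a..t}"
      have "((\<lambda>s. X s $ i) has_real_derivative X' s $ i) (at s within {a..t})"
        using s by (intro has_real_derivative_vec_nth has_vector_derivative_within_subset[OF der]) auto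
      then show "((\<lambda>s. X s $ i - z $ i - E s) has_real_derivative X' s $ i - M * E s) (at s within {a..t})"
        unfolding E_def by (auto intro!: derivative_eq_intros)
    next
      fix i show "X a $ i - z $ i - E a < 0"
        using start E_pos[of a] by (simp add: less_eq_vec_def) (smt (verit))
    next
      fix i s assume s: "a < s" "s \<le> t" and below: "\<forall>j. \<forall>\<sigma>\<in>{a..s}. X \<sigma> $ j - z $ j - E \<sigma> \<le> 0"
        and eq: "X s $ i - z $ i - E s = 0"
      have "X' s $ i \<le> L * E s"
      proof (rule touch)
        show "E s \<le> \<kappa>" using E_mono[OF s(2)] E_t e by simp
        show "\<forall>\<sigma>\<in>{a..s}. X \<sigma> \<le> z + E s *\<^sub>R 1"
        proof (clarsimp simp: less_eq_vec_def)
          fix \<sigma> j assume "a \<le> \<sigma>" "\<sigma> \<le> s"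
          then have "X \<sigma> $ j - z $ j - E \<sigma> \<le> 0" "E \<sigma> \<le> E s" using below E_mono by auto
          then show "X \<sigma> $ j \<le> z $ j + E s" by simp
        qed
      qed (use s E_pos eq in auto)
      also have "\<dots> < M * E s" using M E_pos by simp
      finally show "X' s $ i - M * E s < 0" by simp
    qed
    then show ?thesis by (simp add: E_t)
  qed
  have "X t $ i \<le> z $ i" for i
  proof (rule field_le_epsilon)
    fix e :: real assume "0 < e"
    with main[of "min e \<kappa>" i] \<kappa> show "X t $ i \<le> z $ i + e" by auto
  qed
  then show ?thesis by (simp add: less_eq_vec_def)
qed

text \<open>
  Above the level \<open>k\<close> the function falls at rate at least \<open>c\<close>, so it comes down to \<open>k\<close> in finite time,
  and it cannot rise above \<open>k\<close> again: an excursion would have to start at level \<open>k\<close> and decrease.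
\<close>

lemma eventually_below_level:
  fixes v :: "real \<Rightarrow> real"
  assumes der: "\<And>t. T \<le> t \<Longrightarrow> (v has_real_derivative v' t) (at t within {T..})"
    and c: "0 < c"
    and dec: "\<And>t. T \<le> t \<Longrightarrow> k \<le> v t \<Longrightarrow> v' t \<le> - c"
  shows "eventually (\<lambda>t. v t \<le> k) at_top"
proof -
  have cont: "continuous_on {T..} v"
    using der by (metis DERIV_continuous atLeast_iff continuous_on_eq_continuous_within)
  have drop: "v t \<le> v s - c * (t - s)" if "T \<le> s" "s < t" "\<And>\<sigma>. s < \<sigma> \<Longrightarrow> \<sigma> < t \<Longrightarrow> k \<le> v \<sigma>" for s t
  proof -
    have cont_st: "continuous_on {s..t} v" using cont that by (auto elim: continuous_on_subset)
    have der_st: "(v has_derivative (*) (v' \<xi>)) (at \<xi>)" if \<xi>: "s < \<xi>" "\<xi> < t" for \<xi>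
    proof -
      have "at \<xi> within {T..} = at \<xi>" using \<xi> \<open>T \<le> s\<close> by (intro at_within_interior) auto
      with der[of \<xi>] \<xi> \<open>T \<le> s\<close> show ?thesis by (simp add: has_field_derivative_def)
    qed
    obtain \<xi> where \<xi>: "s < \<xi>" "\<xi> < t" "v t - v s = v' \<xi> * (t - s)"
      by (rule mvt[OF \<open>s < t\<close> cont_st der_st])
    have "v' \<xi> \<le> - c" using that \<xi> by (intro dec) auto
    then have "v' \<xi> * (t - s) \<le> - c * (t - s)" using that by (intro mult_right_mono) auto
    with \<xi>(3) show ?thesis by simp
  qed
  have "\<exists>t1\<ge>T. v t1 \<le> k"
  proof (rule ccontr)
    assume "\<not> ?thesis"
    then have above: "\<And>t. T \<le> t \<Longrightarrow> k < v t" by force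
    \<comment> \<open>By this time a descent at rate \<open>c\<close> has reached the level \<open>k\<close>.\<close>
    define t where "t = T + (v T - k) / c"
    have "T < t" using above[of T] c by (simp add: t_def)
    then have "v t \<le> v T - c * (t - T)" using above by (intro drop) (auto simp: less_imp_le)
    also have "\<dots> = k" using c by (simp add: t_def)
    finally show False using above[of t] \<open>T < t\<close> by simp
  qed
  then obtain t1 where t1: "T \<le> t1" "v t1 \<le> k" by blast
  have "v t \<le> k" if "t1 \<le> t" for t
  proof (rule ccontr)
    assume nle: "\<not> v t \<le> k"
    define S where "S = {s \<in> {t1..t}. v s \<le> k}"
    have "closed S" unfolding S_def
      using t1 by (intro continuous_on_closed_Collect_le continuous_on_const closed_atLeastAtMost continuous_on_subset[OF cont]) auto
    moreover have "t1 \<in> S" using t1 that by (simp add: S_def)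
    moreover have bdd: "bdd_above S" by (rule bdd_aboveI[of _ t]) (auto simp: S_def)
    ultimately have inS: "Sup S \<in> S" by (metis closed_contains_Sup empty_iff)
    \<comment> \<open>The start of the excursion that is above \<open>k\<close> at time \<open>t\<close>.\<close>
    define s where "s = Sup S"
    have s: "t1 \<le> s" "s \<le> t" "v s \<le> k" using inS by (auto simp: S_def s_def)
    then have "s < t" using nle by (cases "s = t") auto
    have "v t \<le> v s - c * (t - s)"
    proof (rule drop)
      fix \<sigma> assume \<sigma>: "s < \<sigma>" "\<sigma> < t"
      show "k \<le> v \<sigma>"
      proof (rule ccontr)
        assume "\<not> k \<le> v \<sigma>"
        then have "\<sigma> \<in> S" using \<sigma> s by (simp add: S_def)
        then show False using cSup_upper[OF _ bdd] \<sigma> by (fastforce simp: s_def)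
      qed
    qed (use s t1 \<open>s < t\<close> in auto)
    moreover have "0 < c * (t - s)" using c \<open>s < t\<close> by simp
    ultimately show False using nle s by linarith
  qed
  then show ?thesis by (auto simp: eventually_at_top_linorder)
qed

section \<open>The undelayed field\<close>

lemma isCont_componentwise_box:
  fixes h :: "real^'n \<Rightarrow> real^'m"
  assumes "isCont h w" "0 < e"
  obtains \<delta> where "0 < \<delta>" "\<And>v i. (\<forall>j. \<bar>v $ j - w $ j\<bar> \<le> \<delta>) \<Longrightarrow> \<bar>h v $ i - h w $ i\<bar> < e"
proof -
  obtain d where d: "d > 0" "\<And>v. dist v w < d \<Longrightarrow> dist (h v) (h w) < e"
    using assms unfolding continuous_at_eps_delta by (metis dist_commute)
  define \<delta> where "\<delta> = d / (norm (1::real^'n) + 1)"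
  have "0 < norm (1::real^'n) + 1" by (simp add: add_nonneg_pos)
  then have \<delta>: "0 < \<delta>" "\<delta> * (norm (1::real^'n) + 1) = d" using d(1) by (auto simp: \<delta>_def)
  show thesis
  proof (rule that[OF \<delta>(1)])
    fix v i assume v: "\<forall>j. \<bar>v $ j - w $ j\<bar> \<le> \<delta>"
    have "norm (v - w) \<le> norm (\<delta> *\<^sub>R (1::real^'n))"
      using v \<delta>(1) by (intro norm_le_componentwise_cart) auto
    also have "\<dots> < d" using \<delta> by (simp add: algebra_simps)
    finally have "norm (h v - h w) < e" using d(2) by (simp add: dist_norm)
    then show "\<bar>h v $ i - h w $ i\<bar> < e"
      using component_le_norm_cart[of "h v - h w" i] by simp
  qed
qed

context delay_system
begin

text \<open>
  Time \<open>0\<close> stands for any time: on constant histories the value of \<open>g\<close> does not depend on it.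
\<close>

definition undelayed_field :: "real^'n \<Rightarrow> real^'n" where
  "undelayed_field v = f v + g 0 (const_history r v)"

lemma const_history_in: "const_history r v \<in> mspace (history_space r)"
  by (auto simp: mspace_history_space const_history_def intro: continuous_on_eq[OF continuous_on_const])

text \<open>
  Constant histories form an isometric copy of the state space, so Lipschitz bounds for \<open>g\<close> on
  histories become Lipschitz bounds on vectors.
\<close>

lemma mdist_const_history:
  "mdist (history_space r) (const_history r v) (const_history r w) = norm (v - w)"
proof -
  have "(SUP \<theta>\<in>{-r..0}. norm (const_history r v \<theta> - const_history r w \<theta>)) = (SUP \<theta>\<in>{-r..0}. norm (v - w))"
    by (intro SUP_cong) (auto simp: const_history_def)
  also have "\<dots> = norm (v - w)" using delay_nonneg by (intro cSUP_const) auto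
  finally show ?thesis
    using mdist_history_space[OF delay_nonneg const_history_in const_history_in] by metis
qed

lemma g_const_mono: "v \<le> w \<Longrightarrow> g 0 (const_history r v) \<le> g 0 (const_history r w)"
  by (rule g_mono[OF order_refl const_history_in const_history_in]) (simp add: const_history_def)

lemma undelayed_field_cooperative: "v \<le> w \<Longrightarrow> v $ i = w $ i \<Longrightarrow> undelayed_field v $ i \<le> undelayed_field w $ i"
  using f_cooperative[of v w i] g_const_mono[of v w]
  unfolding undelayed_field_def vector_add_component by (intro add_mono) (auto simp: less_eq_vec_def)

lemma undelayed_field_0: "undelayed_field 0 = 0"
  using equilibrium by (simp add: undelayed_field_def)

lemma g_const_pointwise_Lipschitz:
  obtains \<kappa> L where "0 < \<kappa>" "0 \<le> L"
    "\<And>w. norm (w - v) < \<kappa> \<Longrightarrow>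
       norm (g 0 (const_history r w) - g 0 (const_history r v)) \<le> L * norm (w - v)"
proof -
  obtain u where u: "u > 0" and lip: "Lipschitz_continuous_map
      (submetric (history_space r) (mball_of (history_space r) (const_history r v) u)) euclidean_metric (g 0)"
    using g_locally_Lipschitz[OF _ const_history_in] by force
  obtain B where B: "B > 0" "\<And>\<phi> \<psi>. \<phi> \<in> mball_of (history_space r) (const_history r v) u \<Longrightarrow>
      \<psi> \<in> mball_of (history_space r) (const_history r v) u \<Longrightarrow> dist (g 0 \<phi>) (g 0 \<psi>) \<le> B * mdist (history_space r) \<phi> \<psi>"
    using lip unfolding Lipschitz_continuous_map_pos
    by (auto simp: mball_of_def Metric_space.in_mball)
  have mem: "const_history r w \<in> mball_of (history_space r) (const_history r v) u" if "norm (w - v) < u" for w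
    using that by (simp add: mball_of_def Metric_space.in_mball const_history_in mdist_const_history norm_minus_commute)
  show thesis
  proof (rule that[of u B])
    fix w assume "norm (w - v) < u"
    then show "norm (g 0 (const_history r w) - g 0 (const_history r v)) \<le> B * norm (w - v)"
      using B(2)[OF mem mem, of w v] u by (simp add: dist_norm mdist_const_history)
  qed (use u B in auto)
qed

lemma undelayed_field_pointwise_Lipschitz:
  obtains \<kappa> L where "0 < \<kappa>" "0 \<le> L" "\<And>w. norm (w - v) < \<kappa> \<Longrightarrow> norm (undelayed_field w - undelayed_field v) \<le> L * norm (w - v)"
proof -
  obtain u L where u: "u > 0" and L: "L-lipschitz_on (cball v u) f"
    using f_locally_Lipschitz by blast
  obtain \<kappa> B where \<kappa>: "0 < \<kappa>" "0 \<le> B" and B: "\<And>w. norm (w - v) < \<kappa> \<Longrightarrow>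
       norm (g 0 (const_history r w) - g 0 (const_history r v)) \<le> B * norm (w - v)"
    using g_const_pointwise_Lipschitz by blast
  show thesis
  proof (rule that[of "min u \<kappa>" "L + B"])
    fix w assume w: "norm (w - v) < min u \<kappa>"
    have "norm (f w - f v) \<le> L * norm (w - v)"
      using lipschitz_onD[OF L, of w v] w u by (simp add: dist_norm norm_minus_commute)
    moreover have "norm (g 0 (const_history r w) - g 0 (const_history r v)) \<le> B * norm (w - v)"
      using w B by simp
    ultimately show "norm (undelayed_field w - undelayed_field v) \<le> (L + B) * norm (w - v)"
      using norm_triangle_ineq[of "f w - f v" "g 0 (const_history r w) - g 0 (const_history r v)"]
      by (simp add: undelayed_field_def algebra_simps)
  qed (use u \<kappa> lipschitz_on_nonneg[OF L] in auto)
qed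

text \<open>
  The barriers used below are moved by a multiple of the all-ones vector; this is the error made by
  evaluating the field on the moved barrier, in the form that \<open>stays_below_equal_bound\<close> expects.
\<close>

lemma undelayed_field_diagonal_Lipschitz:
  obtains \<kappa> L where "0 < \<kappa>" "\<And>e i. \<bar>e\<bar> \<le> \<kappa> \<Longrightarrow> \<bar>undelayed_field (v + e *\<^sub>R 1) $ i - undelayed_field v $ i\<bar> \<le> L * \<bar>e\<bar>"
proof -
  obtain \<kappa> L where \<kappa>: "0 < \<kappa>" "0 \<le> L"
    and L: "\<And>w. norm (w - v) < \<kappa> \<Longrightarrow> norm (undelayed_field w - undelayed_field v) \<le> L * norm (w - v)"
    using undelayed_field_pointwise_Lipschitz by blast
  define N where "N = norm (1::real^'n)"
  have N: "0 \<le> N" by (simp add: N_def)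
  show thesis
  proof (rule that[of "\<kappa> / (N + 1)" "L * N"])
    fix e :: real and i assume e: "\<bar>e\<bar> \<le> \<kappa> / (N + 1)"
    have "\<bar>e\<bar> * N < \<kappa>"
    proof (cases "e = 0")
      case False
      have "\<bar>e\<bar> * (N + 1) \<le> \<kappa>" using e N by (simp add: pos_le_divide_eq)
      then show ?thesis using False by (simp add: distrib_left)
    qed (use \<kappa> in auto)
    then have "norm (undelayed_field (v + e *\<^sub>R 1) - undelayed_field v) \<le> L * (\<bar>e\<bar> * N)"
      using L[of "v + e *\<^sub>R 1"] by (simp add: N_def)
    then show "\<bar>undelayed_field (v + e *\<^sub>R 1) $ i - undelayed_field v $ i\<bar> \<le> L * N * \<bar>e\<bar>"
      using component_le_norm_cart[of "undelayed_field (v + e *\<^sub>R 1) - undelayed_field v" i] by (simp add: mult_ac)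
  qed (use \<kappa> N in auto)
qed

lemma isCont_f: "isCont f v"
proof -
  obtain u L where "u > 0" "L-lipschitz_on (cball v u) f"
    using f_locally_Lipschitz by blast
  then show ?thesis
    using continuous_on_interior[OF lipschitz_on_continuous_on] by (metis centre_in_ball interior_cball)
qed

lemma isCont_g_const: "isCont (\<lambda>v. g 0 (const_history r v)) v"
proof -
  obtain \<kappa> L where \<kappa>: "0 < \<kappa>" "0 \<le> L" and L: "\<And>w. norm (w - v) < \<kappa> \<Longrightarrow>
       norm (g 0 (const_history r w) - g 0 (const_history r v)) \<le> L * norm (w - v)"
    using g_const_pointwise_Lipschitz by blast
  have "((\<lambda>w. L * norm (w - v)) \<longlongrightarrow> L * norm (v - v)) (at v)"
    by (intro tendsto_intros)
  then have "((\<lambda>w. L * norm (w - v)) \<longlongrightarrow> 0) (at v)" by simp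
  moreover have "\<forall>\<^sub>F w in at v. norm (g 0 (const_history r w) - g 0 (const_history r v)) \<le> L * norm (w - v)"
    unfolding eventually_at using \<kappa>(1) L by (auto simp: dist_norm)
  ultimately have "((\<lambda>w. g 0 (const_history r w) - g 0 (const_history r v)) \<longlongrightarrow> 0) (at v)"
    by (rule Lim_null_comparison[rotated])
  then show ?thesis by (simp add: isCont_def LIM_zero_iff)
qed

section \<open>The undelayed trajectory\<close>

lemma undelayed_derivative:
  assumes "undelayed_solution r f g {0..} 0 v y" "0 \<le> t"
  shows "(y has_vector_derivative undelayed_field (y t)) (at t within {0..})"
proof -
  have "(y has_vector_derivative (f (y t) + g t (const_history r (y t)))) (at t within {0..})"
    using assms by (simp add: undelayed_solution_def)
  then show ?thesis
    unfolding undelayed_field_def using g_const_history[of t 0 "y t"] assms(2) by simp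
qed

text \<open>
  When component \<open>i\<close> touches the lowered barrier \<open>w - e\<close>, cooperativity bounds its velocity from
  below by the field at \<open>w - e\<close>, which is at least \<open>- L * e\<close> because \<open>F w \<ge> 0\<close>.
\<close>

lemma undelayed_above_subequilibrium:
  assumes sol: "undelayed_solution r f g {0..} 0 v y"
    and "w \<le> y 0" "0 \<le> undelayed_field w" "0 \<le> t"
  shows "w \<le> y t"
proof -
  obtain \<kappa> L where \<kappa>: "0 < \<kappa>"
    and L: "\<And>e i. \<bar>e\<bar> \<le> \<kappa> \<Longrightarrow> \<bar>undelayed_field (w + e *\<^sub>R 1) $ i - undelayed_field w $ i\<bar> \<le> L * \<bar>e\<bar>"
    using undelayed_field_diagonal_Lipschitz by blast
  have "- y t \<le> - w"
  proof (rule stays_below_equal_bound[where X="\<lambda>t. - y t" and a=0 and X'="\<lambda>t. - undelayed_field (y t)" and L=L, OF _ _ \<kappa>])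
    fix t i and e :: real
    assume t: "0 \<le> t" and e: "0 < e" "e \<le> \<kappa>" and below: "\<forall>s\<in>{0..t}. - y s \<le> - w + e *\<^sub>R 1"
      and eq: "(- y t) $ i = (- w) $ i + e"
    have "w + (- e) *\<^sub>R 1 \<le> y t"
      using bspec[OF below, of t] t by (simp add: less_eq_vec_def algebra_simps)
    moreover have "(w + (- e) *\<^sub>R 1) $ i = y t $ i" using eq by simp
    ultimately have "undelayed_field (w + (- e) *\<^sub>R 1) $ i \<le> undelayed_field (y t) $ i" by (rule undelayed_field_cooperative)
    moreover have "0 \<le> undelayed_field w $ i" using assms(3) by (simp add: less_eq_vec_def)
    ultimately show "(- undelayed_field (y t)) $ i \<le> L * e"
      using L[of "- e" i] e by simp
  qed (use assms undelayed_derivative[OF sol] in \<open>auto intro: has_vector_derivative_minus\<close>)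
  then show ?thesis by simp
qed

text \<open>
  The trajectory stays above a barrier that decays exponentially from a small multiple of the
  all-ones vector: near the origin the field at \<open>c *\<^sub>R 1\<close> is at least \<open>- L * c\<close>, so a decay rate larger
  than \<open>L\<close> is fast enough. Strict positivity at all times matters because a component that reaches
  \<open>0\<close> could have infinite level times.
\<close>

lemma undelayed_positive:
  assumes sol: "undelayed_solution r f g {0..} 0 v y"
    and pos: "\<And>i. 0 < y 0 $ i" and t: "0 \<le> t"
  shows "0 < y t $ i"
proof -
  obtain \<kappa> L where \<kappa>: "0 < \<kappa>"
    and L: "\<And>e i. \<bar>e\<bar> \<le> \<kappa> \<Longrightarrow> \<bar>undelayed_field (0 + e *\<^sub>R 1) $ i - undelayed_field 0 $ i\<bar> \<le> L * \<bar>e\<bar>"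
    using undelayed_field_diagonal_Lipschitz by blast
  define M where "M = \<bar>L\<bar> + 1"
  define \<epsilon> where "\<epsilon> = Min (insert \<kappa> (range (\<lambda>i. y 0 $ i / 2)))"
  have \<epsilon>: "0 < \<epsilon>" "\<epsilon> \<le> \<kappa>" using \<kappa> pos by (auto simp: \<epsilon>_def)
  have \<epsilon>_lt: "\<epsilon> < y 0 $ i" for i
  proof -
    have "\<epsilon> \<le> y 0 $ i / 2" unfolding \<epsilon>_def by (rule Min_le) auto
    with pos[of i] show ?thesis by linarith
  qed
  define E where "E s = \<epsilon> * exp (- M * s)" for s
  have E_pos: "0 < E s" for s using \<epsilon> by (simp add: E_def)
  have "E t - y t $ i < 0"
  proof (rule stays_below_barrier[where u="\<lambda>i s. E s - y s $ i" and a=0 and b=t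
            and u'="\<lambda>i s. - M * E s - undelayed_field (y s) $ i"])
    show "t \<in> {0..t}" using t by simp
  next
    fix i s assume s: "s \<in> {0..t}"
    have "((\<lambda>s. y s $ i) has_real_derivative undelayed_field (y s) $ i) (at s within {0..t})"
      using s by (intro has_real_derivative_vec_nth
          has_vector_derivative_within_subset[OF undelayed_derivative[OF sol]]) auto
    then show "((\<lambda>s. E s - y s $ i) has_real_derivative - M * E s - undelayed_field (y s) $ i) (at s within {0..t})"
      unfolding E_def by (auto intro!: derivative_eq_intros)
  next
    fix i show "E 0 - y 0 $ i < 0" using \<epsilon>_lt by (simp add: E_def)
  next
    fix i s assume s: "0 < s" "s \<le> t" and above: "\<forall>j. \<forall>\<sigma>\<in>{0..s}. E \<sigma> - y \<sigma> $ j \<le> 0"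
      and eq: "E s - y s $ i = 0"
    have "E s *\<^sub>R 1 \<le> y s"
      using above s by (simp add: less_eq_vec_def)
    then have "undelayed_field (E s *\<^sub>R 1) $ i \<le> undelayed_field (y s) $ i"
      using eq by (intro undelayed_field_cooperative) auto
    moreover have "E s \<le> \<kappa>"
    proof -
      have "0 \<le> M * s" using s by (simp add: M_def)
      then have "exp (- M * s) \<le> 1" by simp
      then have "E s \<le> \<epsilon>" using \<epsilon> by (simp add: E_def mult_left_le)
      with \<epsilon> show ?thesis by simp
    qed
    then have "\<bar>undelayed_field (E s *\<^sub>R 1) $ i\<bar> \<le> L * E s"
      using L[of "E s" i] E_pos[of s] by (simp add: undelayed_field_0)
    moreover have "L * E s < M * E s" using E_pos[of s] by (intro mult_strict_right_mono) (auto simp: M_def)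
    ultimately show "- M * E s - undelayed_field (y s) $ i < 0" by simp
  qed
  then show ?thesis using E_pos[of t] by simp
qed

end

section \<open>The level vector\<close>

text \<open>
  With \<open>m\<close> the minimum of \<open>\<eta>\<close> on \<open>[0, u]\<close>, the next level time after \<open>u\<close> is the level time \<open>\<tau>\<close> of \<open>m\<close>.
  It is finite, since \<open>\<eta>\<close> tends to \<open>0 < m\<close>, and at least \<open>u\<close>. Levels above \<open>m\<close> are lost before time \<open>u\<close>,
  and levels below \<open>m\<close> last at least as long as \<open>m\<close>. By continuity \<open>\<eta> \<tau> = m\<close>.
\<close>

lemma next_level_time_attains_minimum:
  fixes \<eta> :: "real \<Rightarrow> real"
  assumes cont: "continuous_on {0..} \<eta>"
    and lim: "(\<eta> \<longlongrightarrow> 0) at_top"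
    and u: "0 \<le> u"
    and s0: "s0 \<in> {0..u}" "\<And>s. s \<in> {0..u} \<Longrightarrow> \<eta> s0 \<le> \<eta> s"
    and pos: "0 < \<eta> s0"
  shows "\<eta> (real_of_ereal (next_level_time \<eta> u)) = \<eta> s0"
proof -
  define m where "m = \<eta> s0"
  define A where "A a = {\<tau>. 0 \<le> \<tau> \<and> (\<forall>s\<in>{0..\<tau>}. a \<le> \<eta> s)}" for a
  have lt: "level_time \<eta> a = Sup (ereal ` A a)" for a by (simp add: level_time_def A_def)
  obtain B where B: "\<And>t. B \<le> t \<Longrightarrow> \<eta> t < m"
    using order_tendstoD(2)[OF lim, of m] pos unfolding m_def eventually_at_top_linorder by blast
  have uA: "u \<in> A m" using u s0 by (simp add: A_def m_def)
  have bdd: "bdd_above (A m)"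
  proof (rule bdd_aboveI)
    fix \<tau> assume "\<tau> \<in> A m"
    then have "m \<le> \<eta> \<tau>" by (simp add: A_def)
    with B[of \<tau>] show "\<tau> \<le> B" by fastforce
  qed
  define \<tau> where "\<tau> = Sup (A m)"
  have lm: "level_time \<eta> m = ereal \<tau>"
  proof -
    obtain C where C: "\<And>\<sigma>. \<sigma> \<in> A m \<Longrightarrow> \<sigma> \<le> C" using bdd by (auto simp: bdd_above_def)
    have "Sup (ereal ` A m) \<le> ereal C" using C by (intro Sup_least) auto
    moreover have "ereal u \<le> Sup (ereal ` A m)" using uA by (intro Sup_upper) auto
    ultimately have "\<bar>Sup (ereal ` A m)\<bar> \<noteq> \<infinity>" by auto
    then show ?thesis unfolding lt \<tau>_def by (simp add: ereal_Sup)
  qed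
  have u\<tau>: "u \<le> \<tau>" unfolding \<tau>_def using uA bdd by (rule cSup_upper)
  have before: "m \<le> \<eta> s" if "0 \<le> s" "s < \<tau>" for s
  proof -
    have "A m \<noteq> {}" "s < Sup (A m)" using uA that(2) by (auto simp: \<tau>_def)
    then obtain \<sigma> where "\<sigma> \<in> A m" "s < \<sigma>" using less_cSupD by blast
    then show ?thesis using that(1) by (simp add: A_def)
  qed
  have "m \<le> \<eta> \<tau>"
  proof (cases "\<tau> = u")
    case True then show ?thesis using u s0 by (simp add: m_def)
  next
    case False
    show ?thesis
    proof (rule ccontr)
      assume "\<not> m \<le> \<eta> \<tau>"
      moreover have "continuous_on {u..\<tau>} (\<lambda>s. \<eta> s)" using cont by (rule continuous_on_subset) (use u in auto)
      ultimately obtain d where d: "d > 0" "\<And>s. s \<in> {u..\<tau>} \<Longrightarrow> dist s \<tau> < d \<Longrightarrow> dist (\<eta> s) (\<eta> \<tau>) < m - \<eta> \<tau>"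
        unfolding continuous_on_iff using u\<tau> by (metis atLeastAtMost_iff diff_gt_0_iff_gt not_le order_refl)
      define s where "s = max u (\<tau> - d/2)"
      have "dist (\<eta> s) (\<eta> \<tau>) < m - \<eta> \<tau>" using d(1) u\<tau> by (intro d(2)) (auto simp: s_def dist_real_def)
      moreover have "m \<le> \<eta> s" using False u u\<tau> d(1) by (intro before) (auto simp: s_def)
      ultimately show False by (simp add: dist_real_def)
    qed
  qed
  moreover have "\<eta> \<tau> \<le> m"
  proof (rule ccontr)
    assume gt: "\<not> \<eta> \<tau> \<le> m"
    have "\<tau> \<in> {0..}" using u u\<tau> by simp
    then obtain d where d: "d > 0" "\<And>s. s \<in> {0..} \<Longrightarrow> dist s \<tau> < d \<Longrightarrow> dist (\<eta> s) (\<eta> \<tau>) < \<eta> \<tau> - m"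
      using cont gt unfolding continuous_on_iff by (metis diff_gt_0_iff_gt not_le)
    have "\<tau> + d/2 \<in> A m"
    proof (clarsimp simp: A_def, intro conjI ballI)
      show "0 \<le> \<tau> + d/2" using \<open>\<tau> \<in> {0..}\<close> d(1) by simp
      fix s assume s: "s \<in> {0..\<tau> + d/2}"
      show "m \<le> \<eta> s"
      proof (cases "s < \<tau>")
        case False
        then have "dist (\<eta> s) (\<eta> \<tau>) < \<eta> \<tau> - m" using s d(1) by (intro d(2)) (auto simp: dist_real_def)
        then show ?thesis by (simp add: dist_real_def abs_less_iff)
      qed (use before s in auto)
    qed
    then have "\<tau> + d/2 \<le> \<tau>" unfolding \<tau>_def using bdd by (rule cSup_upper)
    with d(1) show False by simp
  qed
  ultimately have \<eta>\<tau>: "\<eta> \<tau> = m" by simp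
  have "next_level_time \<eta> u = ereal \<tau>"
    unfolding next_level_time_def
  proof (rule cInf_eq_minimum)
    have "m \<in> {0..\<eta> 0}" using pos s0(2)[of 0] u by (simp add: m_def)
    then show "ereal \<tau> \<in> {\<tau>. ereal u \<le> \<tau> \<and> (\<exists>a\<in>{0..\<eta> 0}. level_time \<eta> a = \<tau>)}"
      using lm u\<tau> by auto
  next
    fix \<sigma> assume "\<sigma> \<in> {\<tau>. ereal u \<le> \<tau> \<and> (\<exists>a\<in>{0..\<eta> 0}. level_time \<eta> a = \<tau>)}"
    then obtain a where a: "a \<in> {0..\<eta> 0}" "level_time \<eta> a = \<sigma>" and \<sigma>: "ereal u \<le> \<sigma>" by auto
    have "a \<le> m"
    proof (rule ccontr)
      assume "\<not> a \<le> m"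
      then have "\<eta> s0 < a" by (simp add: m_def)
      then obtain d where d: "d > 0" "\<And>s. s \<in> {0..} \<Longrightarrow> dist s s0 < d \<Longrightarrow> dist (\<eta> s) (\<eta> s0) < a - \<eta> s0"
        using cont s0(1) unfolding continuous_on_iff by (metis atLeast_iff atLeastAtMost_iff diff_gt_0_iff_gt)
      have "s0 \<noteq> 0" using a(1) \<open>\<eta> s0 < a\<close> by auto
      then have "0 < s0" using s0(1) by simp
      \<comment> \<open>The level \<open>a\<close> is already lost slightly before \<open>s0\<close>. If \<open>s0\<close> itself were used, the case \<open>s0 = u\<close>
        would give only \<open>level_time \<eta> a \<le> u\<close>.\<close>
      define s where "s = max 0 (s0 - d/2)"
      have s: "0 \<le> s" "s < s0" using d(1) \<open>0 < s0\<close> by (auto simp: s_def)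
      have "dist (\<eta> s) (\<eta> s0) < a - \<eta> s0" using d(1) s by (intro d(2)) (auto simp: s_def dist_real_def)
      then have \<eta>s: "\<eta> s < a" by (simp add: dist_real_def)
      have "level_time \<eta> a \<le> ereal s"
        unfolding lt
      proof (rule Sup_least)
        fix q assume "q \<in> ereal ` A a"
        then obtain \<rho> where \<rho>: "\<rho> \<in> A a" "q = ereal \<rho>" by blast
        have "\<rho> \<le> s"
        proof (rule ccontr)
          assume "\<not> \<rho> \<le> s"
          with \<rho>(1) s(1) have "a \<le> \<eta> s" by (simp add: A_def)
          with \<eta>s show False by simp
        qed
        with \<rho>(2) show "q \<le> ereal s" by simp
      qed
      also have "\<dots> < ereal u" using s s0(1) by simp
      finally show False using a(2) \<sigma> by simp
    qed
    then have "A m \<subseteq> A a" by (auto simp: A_def intro: order_trans)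
    then have "level_time \<eta> m \<le> level_time \<eta> a" unfolding lt by (intro Sup_subset_mono image_mono)
    then show "ereal \<tau> \<le> \<sigma>" using lm a(2) by simp
  qed
  then show ?thesis using \<eta>\<tau> by (simp add: m_def)
qed

context delay_system
begin

lemma level_vector_running_minimum:
  assumes sol: "undelayed_solution r f g {0..} 0 v y"
    and pos: "\<And>i. 0 < y 0 $ i"
    and lim: "\<And>i. ((\<lambda>t. y t $ i) \<longlongrightarrow> 0) at_top"
    and u: "0 \<le> u"
  obtains s where "s \<in> {0..u}" "y s $ i = level_vector y u $ i"
    "\<And>\<sigma>. \<sigma> \<in> {0..u} \<Longrightarrow> level_vector y u $ i \<le> y \<sigma> $ i"
proof -
  have cont: "continuous_on {0..} (\<lambda>t. y t $ i)"
    using DERIV_continuous[OF has_real_derivative_vec_nth[OF undelayed_derivative[OF sol]]]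
    by (simp add: continuous_on_eq_continuous_within)
  have "\<exists>s\<in>{0..u}. \<forall>\<sigma>\<in>{0..u}. y s $ i \<le> y \<sigma> $ i"
    using u by (intro continuous_attains_inf continuous_on_subset[OF cont]) auto
  then obtain s where s: "s \<in> {0..u}" "\<And>\<sigma>. \<sigma> \<in> {0..u} \<Longrightarrow> y s $ i \<le> y \<sigma> $ i" by blast
  have "0 < y s $ i" using s(1) by (intro undelayed_positive[OF sol pos]) auto
  then have "level_vector y u $ i = y s $ i"
    using next_level_time_attains_minimum[OF cont lim u s] by (simp add: level_vector_def)
  with s that show thesis by metis
qed

text \<open>
  If component \<open>i\<close> attains its minimum over \<open>[0, u]\<close> at time \<open>s > 0\<close>, then its left derivative there is
  nonpositive, and cooperativity carries this over from \<open>y s\<close> to the smaller vector of minima. The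
  minimum is not attained at \<open>0\<close> because the component is smaller at time \<open>u\<close>.
\<close>

lemma undelayed_field_level_vector_le_0:
  assumes sol: "undelayed_solution r f g {0..} 0 v y"
    and pos: "\<And>i. 0 < y 0 $ i"
    and lim: "\<And>i. ((\<lambda>t. y t $ i) \<longlongrightarrow> 0) at_top"
    and u: "0 \<le> u" and dec: "\<And>i. y u $ i < y 0 $ i"
  shows "undelayed_field (level_vector y u) \<le> 0"
proof -
  note rm = level_vector_running_minimum[OF sol pos lim u]
  have le: "level_vector y u \<le> y \<sigma>" if "\<sigma> \<in> {0..u}" for \<sigma>
    unfolding less_eq_vec_def using rm that by metis
  have "undelayed_field (level_vector y u) $ i \<le> 0" for i
  proof -
    obtain s where s: "s \<in> {0..u}" "y s $ i = level_vector y u $ i" using rm by blast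
    have "y s $ i < y 0 $ i"
      using s(2) le[of u] u dec[of i] by (simp add: less_eq_vec_def) (metis le_less_trans)
    then have "0 < s" using s(1) by (cases "s = 0") auto
    have "undelayed_field (level_vector y u) $ i \<le> undelayed_field (y s) $ i"
      using s by (intro undelayed_field_cooperative le) auto
    also have "\<dots> \<le> 0"
    proof (rule ccontr)
      assume "\<not> undelayed_field (y s) $ i \<le> 0"
      then obtain d where d: "d > 0" "\<And>h. h > 0 \<Longrightarrow> s - h \<in> {0..} \<Longrightarrow> h < d \<Longrightarrow> y (s - h) $ i < y s $ i"
        using has_real_derivative_pos_inc_left[OF has_real_derivative_vec_nth[OF undelayed_derivative[OF sol, of s]], of i] \<open>0 < s\<close>
        by auto
      define h where "h = min (d/2) s"
      have "y (s - h) $ i < y s $ i" using d(1) \<open>0 < s\<close> by (intro d(2)) (auto simp: h_def)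
      moreover have "level_vector y u $ i \<le> y (s - h) $ i"
        using le[of "s - h"] s(1) d(1) \<open>0 < s\<close> by (auto simp: less_eq_vec_def h_def)
      ultimately show False using s(2) by simp
    qed
    finally show ?thesis .
  qed
  then show ?thesis by (simp add: less_eq_vec_def)
qed

section \<open>The delayed trajectory\<close>

lemma delayed_derivative:
  assumes "delayed_solution r f g {t0..} t0 \<phi> x" "t0 \<le> t"
  shows "(x has_vector_derivative (f (x t) + g t (segment r x t))) (at t within {t0..})"
  using assms by (simp add: delayed_solution_def)

lemma delayed_history:
  assumes "delayed_solution r f g {t0..} t0 \<phi> x" "t0 - r \<le> s" "s \<le> t0"
  shows "x s = \<phi> (s - t0)"
proof -
  have "\<phi> (s - t0) = segment r x t0 (s - t0)" using assms(1) by (simp add: delayed_solution_def)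
  also have "\<dots> = x s" using assms(2,3) by (simp add: segment_def)
  finally show ?thesis by simp
qed

lemma segment_in:
  assumes sol: "delayed_solution r f g {t0..} t0 \<phi> x"
    and \<phi>: "\<phi> \<in> mspace (history_space r)" and t: "t0 \<le> t"
  shows "segment r x t \<in> mspace (history_space r)"
proof -
  have c1: "continuous_on {t0-r..t0} x"
  proof (rule continuous_on_eq)
    show "continuous_on {t0-r..t0} (\<lambda>s. \<phi> (s - t0))"
    proof (rule continuous_on_compose2[where g = \<phi>])
      show "continuous_on {-r..0} \<phi>" using \<phi> by (simp add: mspace_history_space)
      show "continuous_on {t0-r..t0} (\<lambda>s. s - t0)" by (intro continuous_intros)
    qed auto
  qed (use delayed_history[OF sol] in auto)
  have "continuous_on {t0..} x"
    using has_vector_derivative_continuous[OF delayed_derivative[OF sol]]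
    by (simp add: continuous_on_eq_continuous_within)
  then have "continuous_on ({t0-r..t0} \<union> {t0..}) x"
    using c1 by (intro continuous_on_closed_Un) auto
  then have "continuous_on {t0-r..} x"
    using delay_nonneg by (auto elim: continuous_on_subset)
  then have "continuous_on {-r..0} (\<lambda>\<theta>. x (t + \<theta>))"
  proof (rule continuous_on_compose2[where g = x])
    show "continuous_on {-r..0} (\<lambda>\<theta>. t + \<theta>)" by (intro continuous_intros)
  qed (use t in auto)
  then have "continuous_on {-r..0} (segment r x t)"
    by (rule continuous_on_eq) (auto simp: segment_def)
  then show ?thesis by (simp add: mspace_history_space segment_def)
qed

text \<open>
  This bound and its dual are what removes both the delay and the time dependence from all estimates.
\<close>

lemma g_segment_upper:
  assumes "segment r x t \<in> mspace (history_space r)" "0 \<le> t" "\<And>s. s \<in> {t-r..t} \<Longrightarrow> x s \<le> v"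
  shows "g t (segment r x t) \<le> g 0 (const_history r v)"
proof -
  have "g t (segment r x t) \<le> g t (const_history r v)"
    using assms by (intro g_mono const_history_in) (auto simp: segment_def const_history_def)
  then show ?thesis using g_const_history[of t 0 v] assms(2) by simp
qed

lemma g_segment_lower:
  assumes "segment r x t \<in> mspace (history_space r)" "0 \<le> t" "\<And>s. s \<in> {t-r..t} \<Longrightarrow> v \<le> x s"
  shows "g 0 (const_history r v) \<le> g t (segment r x t)"
proof -
  have "g t (const_history r v) \<le> g t (segment r x t)"
    using assms by (intro g_mono const_history_in) (auto simp: segment_def const_history_def)
  then show ?thesis using g_const_history[of t 0 v] assms(2) by simp
qed

text \<open>
  At a first contact with \<open>z + e\<close> the whole history lies below \<open>z + e\<close>, so component \<open>i\<close> has velocity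
  at most \<open>F\<^sub>i (z + e) \<le> L * e\<close>.
\<close>

lemma delayed_below_superequilibrium:
  assumes sol: "delayed_solution r f g {t0..} t0 \<phi> x"
    and \<phi>: "\<phi> \<in> mspace (history_space r)" "\<And>\<theta>. \<theta> \<in> {-r..0} \<Longrightarrow> \<phi> \<theta> \<le> z"
    and t0: "0 \<le> t0" and z: "undelayed_field z \<le> 0" and t: "t0 \<le> t"
  shows "x t \<le> z"
proof -
  obtain \<kappa> L where \<kappa>: "0 < \<kappa>"
    and L: "\<And>e i. \<bar>e\<bar> \<le> \<kappa> \<Longrightarrow> \<bar>undelayed_field (z + e *\<^sub>R 1) $ i - undelayed_field z $ i\<bar> \<le> L * \<bar>e\<bar>"
    using undelayed_field_diagonal_Lipschitz by blast
  have hist: "x s \<le> z" if "t0 - r \<le> s" "s \<le> t0" for s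
    using delayed_history[OF sol that] \<phi>(2) that by simp
  show ?thesis
  proof (rule stays_below_equal_bound[OF delayed_derivative[OF sol] hist \<kappa>, where L=L])
    fix t i and e :: real
    assume t: "t0 \<le> t" and e: "0 < e" "e \<le> \<kappa>" and below: "\<forall>s\<in>{t0..t}. x s \<le> z + e *\<^sub>R 1"
      and eq: "x t $ i = z $ i + e"
    have ze: "z \<le> z + e *\<^sub>R 1" using e by (simp add: less_eq_vec_def)
    have "x s \<le> z + e *\<^sub>R 1" if "s \<in> {t-r..t}" for s
    proof (cases "t0 \<le> s")
      case False
      then have "x s \<le> z" using that t by (intro hist) auto
      with ze show ?thesis by (rule order_trans[rotated])
    qed (use below that in auto)
    then have "g t (segment r x t) \<le> g 0 (const_history r (z + e *\<^sub>R 1))"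
      using t t0 by (intro g_segment_upper segment_in[OF sol \<phi>(1)]) auto
    moreover have "f (x t) $ i \<le> f (z + e *\<^sub>R 1) $ i"
      using below t eq by (intro f_cooperative) auto
    ultimately have "(f (x t) + g t (segment r x t)) $ i \<le> undelayed_field (z + e *\<^sub>R 1) $ i"
      by (simp add: undelayed_field_def less_eq_vec_def add_mono)
    also have "\<dots> \<le> L * e"
      using L[of e i] e z by (simp add: less_eq_vec_def) (smt (verit))
    finally show "(f (x t) + g t (segment r x t)) $ i \<le> L * e" .
  qed (use t delay_nonneg in auto)
qed

lemma delayed_nonneg:
  assumes sol: "delayed_solution r f g {t0..} t0 \<phi> x"
    and \<phi>: "\<phi> \<in> mspace (history_space r)" "\<And>\<theta>. \<theta> \<in> {-r..0} \<Longrightarrow> 0 \<le> \<phi> \<theta>"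
    and t0: "0 \<le> t0" and t: "t0 \<le> t"
  shows "0 \<le> x t"
proof -
  obtain \<kappa> L where \<kappa>: "0 < \<kappa>"
    and L: "\<And>e i. \<bar>e\<bar> \<le> \<kappa> \<Longrightarrow> \<bar>undelayed_field (0 + e *\<^sub>R 1) $ i - undelayed_field 0 $ i\<bar> \<le> L * \<bar>e\<bar>"
    using undelayed_field_diagonal_Lipschitz by blast
  have hist: "0 \<le> x s" if "t0 - r \<le> s" "s \<le> t0" for s
    using delayed_history[OF sol that] \<phi>(2) that by simp
  have "- x t \<le> 0"
  proof (rule stays_below_equal_bound[OF has_vector_derivative_minus[OF delayed_derivative[OF sol]] _ \<kappa>, where L=L])
    fix t i and e :: real
    assume t: "t0 \<le> t" and e: "0 < e" "e \<le> \<kappa>" and below: "\<forall>s\<in>{t0..t}. - x s \<le> 0 + e *\<^sub>R 1"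
      and eq: "(- x t) $ i = 0 $ i + e"
    have above: "(- e) *\<^sub>R 1 \<le> x s" if "s \<in> {t-r..t}" for s
    proof (cases "t0 \<le> s")
      case True
      with below that have "- x s \<le> e *\<^sub>R 1" by simp
      then show ?thesis by (metis minus_le_iff scaleR_minus_left)
    next
      case False
      then have "0 \<le> x s" using that t by (intro hist) auto
      then show ?thesis using e by (simp add: less_eq_vec_def) (smt (verit))
    qed
    have "g 0 (const_history r ((- e) *\<^sub>R 1)) \<le> g t (segment r x t)"
      using t t0 above by (intro g_segment_lower segment_in[OF sol \<phi>(1)]) auto
    moreover have "f ((- e) *\<^sub>R 1) $ i \<le> f (x t) $ i"
      using above[of t] delay_nonneg eq by (intro f_cooperative) auto
    ultimately have "undelayed_field ((- e) *\<^sub>R 1) $ i \<le> (f (x t) + g t (segment r x t)) $ i"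
      by (simp add: undelayed_field_def less_eq_vec_def add_mono)
    then show "(- (f (x t) + g t (segment r x t))) $ i \<le> L * e"
      using L[of "- e" i] e by (simp add: undelayed_field_0)
  qed (use t delay_nonneg hist[of t0] in auto)
  then show ?thesis by simp
qed

text \<open>
  The hypotheses on \<open>w\<close> say that it is the componentwise upper limit of \<open>x\<close>. From some time on the whole
  history lies below \<open>w + \<delta>\<close>. If \<open>F\<^sub>i w < 0\<close>, continuity makes the velocity of \<open>x\<^sub>i\<close> uniformly negative
  as long as \<open>x\<^sub>i \<ge> w\<^sub>i - \<delta>\<close>, so \<open>x\<^sub>i\<close> eventually stays below \<open>w\<^sub>i - \<delta>\<close>.
\<close>

lemma undelayed_field_limsup_nonneg:
  assumes sol: "delayed_solution r f g {t0..} t0 \<phi> x"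
    and \<phi>: "\<phi> \<in> mspace (history_space r)" and t0: "0 \<le> t0"
    and upper: "\<And>e i. 0 < e \<Longrightarrow> eventually (\<lambda>t. x t $ i \<le> w $ i + e) at_top"
    and least: "\<And>e i. 0 < e \<Longrightarrow> \<not> eventually (\<lambda>t. x t $ i \<le> w $ i - e) at_top"
  shows "0 \<le> undelayed_field w"
proof (rule ccontr)
  assume "\<not> 0 \<le> undelayed_field w"
  then obtain i where i: "undelayed_field w $ i < 0" by (auto simp: less_eq_vec_def not_le)
  \<comment> \<open>One third of the decay is given up for the error in \<open>f\<close> and one third for that in \<open>g\<close>.\<close>
  define c where "c = - undelayed_field w $ i / 3"
  have c: "0 < c" using i by (simp add: c_def)
  obtain \<delta>1 where \<delta>1: "0 < \<delta>1" "\<And>v i. (\<forall>j. \<bar>v $ j - w $ j\<bar> \<le> \<delta>1) \<Longrightarrow> \<bar>f v $ i - f w $ i\<bar> < c"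
    using isCont_componentwise_box[OF isCont_f c] by blast
  obtain \<delta>2 where \<delta>2: "0 < \<delta>2" "\<And>v i. (\<forall>j. \<bar>v $ j - w $ j\<bar> \<le> \<delta>2) \<Longrightarrow>
      \<bar>g 0 (const_history r v) $ i - g 0 (const_history r w) $ i\<bar> < c"
    using isCont_componentwise_box[OF isCont_g_const c] by blast
  define \<delta> where "\<delta> = min \<delta>1 \<delta>2"
  have \<delta>: "0 < \<delta>" "\<delta> \<le> \<delta>1" "\<delta> \<le> \<delta>2" using \<delta>1(1) \<delta>2(1) by (auto simp: \<delta>_def)
  have "eventually (\<lambda>t. \<forall>j. x t $ j \<le> w $ j + \<delta>) at_top"
    using upper[OF \<delta>(1)] by (simp add: eventually_all_finite)
  then obtain T0 where T0: "\<And>t j. T0 \<le> t \<Longrightarrow> x t $ j \<le> w $ j + \<delta>"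
    by (auto simp: eventually_at_top_linorder)
  define T where "T = max t0 (T0 + r)"
  have "eventually (\<lambda>t. x t $ i \<le> w $ i - \<delta>) at_top"
  proof (rule eventually_below_level[OF _ c])
    fix t assume "T \<le> t"
    then show "((\<lambda>t. x t $ i) has_real_derivative (f (x t) + g t (segment r x t)) $ i) (at t within {T..})"
      by (intro has_real_derivative_vec_nth has_vector_derivative_within_subset[OF delayed_derivative[OF sol]])
        (auto simp: T_def)
  next
    fix t assume t: "T \<le> t" and k: "w $ i - \<delta> \<le> x t $ i"
    \<comment> \<open>The largest state that cooperativity can compare with \<open>x t\<close> in component \<open>i\<close>.\<close>
    define v where "v = (\<chi> j. if j = i then x t $ i else w $ j + \<delta>)"
    have xt: "x t $ j \<le> w $ j + \<delta>" for j using t delay_nonneg by (intro T0) (auto simp: T_def)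
    have "f (x t) $ i \<le> f v $ i"
      using xt by (intro f_cooperative) (auto simp: v_def less_eq_vec_def)
    moreover have "\<bar>f v $ i - f w $ i\<bar> < c"
      using xt[of i] k \<delta> by (intro \<delta>1(2)) (auto simp: v_def)
    moreover have "g t (segment r x t) \<le> g 0 (const_history r (w + \<delta> *\<^sub>R 1))"
      using t t0 by (intro g_segment_upper segment_in[OF sol \<phi>]) (auto simp: T_def less_eq_vec_def intro!: T0)
    then have "g t (segment r x t) $ i \<le> g 0 (const_history r (w + \<delta> *\<^sub>R 1)) $ i"
      by (simp add: less_eq_vec_def)
    moreover have "\<bar>g 0 (const_history r (w + \<delta> *\<^sub>R 1)) $ i - g 0 (const_history r w) $ i\<bar> < c"
      using \<delta> by (intro \<delta>2(2)) auto
    moreover have "f w $ i + g 0 (const_history r w) $ i = - (3 * c)"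
      by (simp add: c_def undelayed_field_def[symmetric] flip: vector_add_component)
    ultimately show "(f (x t) + g t (segment r x t)) $ i \<le> - c" by simp
  qed
  with least[OF \<delta>(1)] show False by blast
qed

text \<open>
  The upper limit \<open>w\<close> of \<open>x\<close> lies in \<open>[0, z]\<close> and satisfies \<open>F w \<ge> 0\<close>. Convergence therefore holds
  as soon as \<open>0\<close> is the only such point of the interval.
\<close>

lemma delayed_tendsto_0:
  assumes sol: "delayed_solution r f g {t0..} t0 \<phi> x"
    and \<phi>: "\<phi> \<in> histories r {0..z}" and t0: "0 \<le> t0" and z: "undelayed_field z \<le> 0"
    and no_sub: "\<And>w. 0 \<le> w \<Longrightarrow> w \<le> z \<Longrightarrow> 0 \<le> undelayed_field w \<Longrightarrow> w = 0"
  shows "(x \<longlongrightarrow> 0) at_top"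
proof -
  have hist: "\<phi> \<in> mspace (history_space r)" "\<And>\<theta>. \<theta> \<in> {-r..0} \<Longrightarrow> 0 \<le> \<phi> \<theta>" "\<And>\<theta>. \<theta> \<in> {-r..0} \<Longrightarrow> \<phi> \<theta> \<le> z"
    using \<phi> by (auto simp: histories_def)
  have x0: "0 \<le> x t" if "t0 \<le> t" for t using delayed_nonneg[OF sol hist(1,2) t0 that] .
  have xz: "x t \<le> z" if "t0 \<le> t" for t using delayed_below_superequilibrium[OF sol hist(1,3) t0 z that] .
  define U where "U i = {c. eventually (\<lambda>t. x t $ i \<le> c) at_top}" for i
  define w where "w = (\<chi> i. Inf (U i))"
  have zU: "z $ i \<in> U i" for i
    using xz by (auto simp: U_def eventually_at_top_linorder less_eq_vec_def)
  have lower: "0 \<le> c" if "c \<in> U i" for c i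
  proof -
    have "eventually (\<lambda>t. t0 \<le> t \<and> x t $ i \<le> c) at_top"
      using that eventually_ge_at_top[of t0] unfolding U_def by (auto intro: eventually_conj)
    then obtain t where "t0 \<le> t" "x t $ i \<le> c"
      using eventually_happens'[OF trivial_limit_at_top_linorder] by blast
    with x0[of t] show ?thesis by (simp add: less_eq_vec_def) (metis order_trans)
  qed
  then have bdd: "bdd_below (U i)" for i by (meson bdd_belowI)
  have upper: "eventually (\<lambda>t. x t $ i \<le> w $ i + e) at_top" if "0 < e" for e i
  proof -
    have "\<exists>c\<in>U i. c < w $ i + e"
      using that zU bdd by (subst cInf_less_iff[symmetric]) (auto simp: w_def)
    then show ?thesis unfolding U_def by (auto elim: eventually_mono)
  qed
  have least: "\<not> eventually (\<lambda>t. x t $ i \<le> w $ i - e) at_top" if "0 < e" for e i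
  proof
    assume "eventually (\<lambda>t. x t $ i \<le> w $ i - e) at_top"
    then have "Inf (U i) \<le> w $ i - e" using bdd by (intro cInf_lower) (auto simp: U_def)
    then show False using that by (simp add: w_def)
  qed
  have "w = 0"
  proof (rule no_sub)
    show "0 \<le> w" using lower zU by (auto simp: less_eq_vec_def w_def intro!: cInf_greatest)
    show "w \<le> z" using zU bdd by (auto simp: less_eq_vec_def w_def intro!: cInf_lower)
    show "0 \<le> undelayed_field w" using undelayed_field_limsup_nonneg[OF sol hist(1) t0 upper least] .
  qed
  have "((\<lambda>t. x t $ i) \<longlongrightarrow> 0) at_top" for i
  proof (rule order_tendstoI)
    fix a :: real assume "a < 0"
    have "a < x t $ i" if "t0 \<le> t" for t
      using x0[OF that] \<open>a < 0\<close> by (auto simp: less_eq_vec_def intro: less_le_trans)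
    then show "eventually (\<lambda>t. a < x t $ i) at_top"
      by (auto simp: eventually_at_top_linorder)
  next
    fix a :: real assume "0 < a"
    then show "eventually (\<lambda>t. x t $ i < a) at_top"
      using upper[of "a/2" i] \<open>w = 0\<close> by (auto elim: eventually_mono)
  qed
  then show ?thesis by (intro vec_tendstoI) simp
qed

end

section \<open>Convergence\<close>

theorem lemma1:
  fixes r :: real
    and f :: "real^'n \<Rightarrow> real^'n"
    and g :: "real \<Rightarrow> (real \<Rightarrow> real^'n) \<Rightarrow> real^'n"
    and y x :: "real \<Rightarrow> real^'n"
    and \<phi> :: "real \<Rightarrow> real^'n"
    and \<zeta> :: "real^'n"
    and tp t0 :: real
  assumes "delay_system r f g"
    and "undelayed_solution r f g {0..} 0 (y 0) y"
    and "\<And>i. 0 < y 0 $ i"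
    and "\<And>i. ((\<lambda>t. y t $ i) \<longlongrightarrow> 0) at_top"
    and "0 \<le> tp"
    and "\<And>i. y tp $ i < y 0 $ i"
    and "\<zeta> = level_vector y tp"
    and "0 \<le> t0"
    and "\<phi> \<in> histories r {0..\<zeta>}"
    and "delayed_solution r f g {t0..} t0 \<phi> x"
  shows "(x \<longlongrightarrow> 0) at_top"
proof -
  interpret delay_system r f g by fact
  show ?thesis
  proof (rule delayed_tendsto_0[OF assms(10,9,8)])
    show "undelayed_field \<zeta> \<le> 0"
      unfolding assms(7) by (rule undelayed_field_level_vector_le_0[OF assms(2-6)])
  next
    fix w assume w: "0 \<le> w" "w \<le> \<zeta>" "0 \<le> undelayed_field w"
    have "\<zeta> $ i \<le> y 0 $ i" for i
      using level_vector_running_minimum[OF assms(2-5), of i] assms(5,7) by (metis atLeastAtMost_iff order_refl)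
    then have "w \<le> y 0" using w(2) by (meson less_eq_vec_def order_trans)
    then have wy: "w \<le> y t" if "0 \<le> t" for t
      using undelayed_above_subequilibrium[OF assms(2) _ w(3) that] by blast
    have "w $ i \<le> 0" for i
    proof (rule tendsto_lowerbound[OF assms(4)])
      show "\<forall>\<^sub>F t in at_top. w $ i \<le> y t $ i"
        using wy by (auto simp: eventually_at_top_linorder less_eq_vec_def)
    qed simp
    with w(1) show "w = 0" by (auto simp: vec_eq_iff less_eq_vec_def intro: antisym)
  qed
qed

end
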